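(* Let $D^-$ be the additive code defined in the context and $\Gamma_{D^-}$ its coset graph. Then $\Gamma_{D^-}$ is a distance-regular graph with intersection array $\{33,30,15;1,2,15\}$, i.e. $b_0=33,b_1=30,b_2=15$ and $c_1=1,c_2=2,c_3=15$, where for vertices $u,v$ at distance $i$, $b_i$ is the number of neighbours of $v$ at distance $i+1$ from $u$ and $c_i$ the number of neighbours of $v$ at distance $i-1$ from $u$.
   Context: $\mathbb{F}_4=\{0,1,\omega,\omega^2\}$ with $\omega^2=\omega+1$. An additive code of length $n$ over $\mathbb{F}_4$ is an additive subgroup of $\mathbb{F}_4^n$. The coset graph $\Gamma_C$ of an additive code $C\subseteq\mathbb{F}_4^n$ has as vertices the cosets $x+C$, $x\in\mathbb{F}_4^n$, two cosets being adjacent if their difference contains a vector of Hamming weight $1$. $D^-$ is the $\mathbb{F}_2$-span of the following $12$ vectors of $\mathbb{F}_4^{11}$: $(0,0,0,0,0,\omega^2,\omega^2,0,\omega,1,\omega)$, $(0,0,0,0,0,\omega,0,\omega,\omega,\omega,1)$, $(1,0,0,0,0,1,0,1,\omega^2,\omega^2,1)$, $(\omega,0,0,0,0,0,\omega,1,\omega,\omega,\omega)$, $(0,1,0,0,0,0,1,1,1,\omega^2,\omega^2)$, $(0,\omega,0,0,0,\omega^2,1,\omega^2,\omega,\omega,0)$, $(0,0,1,0,0,\omega,\omega,1,1,0,1)$, $(0,0,\omega,0,0,\omega,1,\omega,\omega^2,\omega^2,0)$, $(0,0,0,1,0,\omega,\omega,\omega,0,1,\omega)$, $(0,0,0,\omega,0,\omega^2,1,1,\omega^2,0,\omega)$,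 $(0,0,0,0,1,\omega^2,\omega^2,\omega^2,1,0,\omega^2)$, $(0,0,0,0,\omega,\omega,1,0,1,\omega,\omega)$. (It is equivalent to the dodecacode punctured in one coordinate; it has $4^6$ codewords, so $\Gamma_{D^-}$ has $4^5=2^{10}$ vertices.) *)

theory Defs
  imports "HOL-Analysis.Analysis" "HOL-Library.Z2" "HOL-Library.Extended_Nat"
    "Graph_Theory.Graph_Theory"
begin

text \<open>\<open>GF4 a b\<close> stands for \<open>a + b\<omega>\<close> with \<open>a\<close>, \<open>b\<close> in the field \<^typ>\<open>bit\<close> of two elements.\<close>

datatype gf4 = GF4 (gf4_fst: bit) (gf4_snd: bit)

lemma gf4_exhaust: obtains "x = GF4 0 0" | "x = GF4 0 1" | "x = GF4 1 0" | "x = GF4 1 1"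
  by (metis bit.exhaust gf4.exhaust)

instantiation gf4 :: field
begin

definition zero_gf4 :: gf4 where "0 = GF4 0 0"

definition one_gf4 :: gf4 where "1 = GF4 1 0"

definition plus_gf4 :: "gf4 \<Rightarrow> gf4 \<Rightarrow> gf4" where
  "x + y = GF4 (gf4_fst x + gf4_fst y) (gf4_snd x + gf4_snd y)"

definition uminus_gf4 :: "gf4 \<Rightarrow> gf4" where
  "- x = GF4 (- gf4_fst x) (- gf4_snd x)"

definition minus_gf4 :: "gf4 \<Rightarrow> gf4 \<Rightarrow> gf4" where
  "x - y = GF4 (gf4_fst x - gf4_fst y) (gf4_snd x - gf4_snd y)"

text \<open>Multiplication is reduced by \<open>\<omega>\<^sup>2 = \<omega> + 1\<close>; the inverse of a nonzero \<open>x\<close> is \<open>x\<^sup>2\<close>.\<close>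

definition times_gf4 :: "gf4 \<Rightarrow> gf4 \<Rightarrow> gf4" where
  "x * y = GF4 (gf4_fst x * gf4_fst y + gf4_snd x * gf4_snd y)
     (gf4_fst x * gf4_snd y + gf4_snd x * gf4_fst y + gf4_snd x * gf4_snd y)"

definition inverse_gf4 :: "gf4 \<Rightarrow> gf4" where "inverse x = x * (x :: gf4)"

definition divide_gf4 :: "gf4 \<Rightarrow> gf4 \<Rightarrow> gf4" where "x div y = x * inverse (y :: gf4)"

lemmas gf4_arith_defs = zero_gf4_def one_gf4_def plus_gf4_def uminus_gf4_def minus_gf4_def
  times_gf4_def inverse_gf4_def divide_gf4_def

instance
proof
  fix a b c :: gf4
  show "a * b * c = a * (b * c)" "a * b = b * a" "1 * a = a"
    "a + b + c = a + (b + c)" "a + b = b + a" "0 + a = a" "- a + a = 0" "a - b = a + - b"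
    "(a + b) * c = a * c + b * c" "a div b = a * inverse b" "inverse (0 :: gf4) = 0"
    by (rule gf4_exhaust[of a]; rule gf4_exhaust[of b]; rule gf4_exhaust[of c];
        simp add: gf4_arith_defs)+
  show "0 \<noteq> (1 :: gf4)"
    by (simp add: gf4_arith_defs)
  show "a \<noteq> 0 \<Longrightarrow> inverse a * a = 1"
    by (rule gf4_exhaust[of a]) (simp_all add: gf4_arith_defs)
qed

end

definition \<omega> :: gf4 where "\<omega> = GF4 0 1"

lemma omega_square: "\<omega>\<^sup>2 = \<omega> + 1"
  by (simp add: \<omega>_def gf4_arith_defs power2_eq_square)

lemma UNIV_gf4: "UNIV = {0, 1, \<omega>, \<omega>\<^sup>2}"
proof -
  have "x \<in> {0, 1, \<omega>, \<omega>\<^sup>2}" for x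
    by (rule gf4_exhaust[of x]) (simp_all add: \<omega>_def gf4_arith_defs power2_eq_square)
  then show ?thesis by auto
qed

lemma card_UNIV_gf4: "CARD(gf4) = 4"
  by (simp add: UNIV_gf4 \<omega>_def gf4_arith_defs power2_eq_square)

instance gf4 :: finite
  by standard (simp add: UNIV_gf4)

definition additive_code :: "(gf4 ^ 'n) set \<Rightarrow> bool" where
  "additive_code C \<longleftrightarrow> 0 \<in> C \<and> (\<forall>x\<in>C. \<forall>y\<in>C. x + y \<in> C) \<and> (\<forall>x\<in>C. - x \<in> C)"

definition hamming_weight :: "gf4 ^ 'n \<Rightarrow> nat" where
  "hamming_weight x = card {i. x $ i \<noteq> 0}"

definition gf2_scale :: "bit \<Rightarrow> gf4 ^ 'n \<Rightarrow> gf4 ^ 'n" where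
  "gf2_scale c x = GF4 c 0 *s x"

interpretation gf2: vector_space gf2_scale
proof
  fix a b :: bit and x y :: "gf4 ^ 'n"
  have add: "GF4 (a + b) 0 = GF4 a 0 + GF4 b 0" and mult: "GF4 (a * b) 0 = GF4 a 0 * GF4 b 0"
    by (simp_all add: gf4_arith_defs)
  show "gf2_scale a (x + y) = gf2_scale a x + gf2_scale a y"
    by (simp add: gf2_scale_def vector_add_ldistrib)
  show "gf2_scale (a + b) x = gf2_scale a x + gf2_scale b x"
    unfolding gf2_scale_def add by (rule vector_sadd_rdistrib)
  show "gf2_scale a (gf2_scale b x) = gf2_scale (a * b) x"
    unfolding gf2_scale_def mult by (rule vector_smult_assoc)
  show "gf2_scale 1 x = x"
    by (simp add: gf2_scale_def flip: one_gf4_def)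
qed

lemma additive_code_gf2_span: "additive_code (gf2.span S)"
  by (simp add: additive_code_def gf2.span_zero gf2.span_add gf2.span_neg)

text \<open>A finite simple graph is a \<^const>\<open>pair_graph\<close>: finite, without loops, with a symmetric
  set of arcs. The distance is infinite for vertices that are not joined by a walk.\<close>

definition graph_dist :: "'a pair_pre_digraph \<Rightarrow> 'a \<Rightarrow> 'a \<Rightarrow> enat" where
  "graph_dist G u v = (INF p \<in> {p. pre_digraph.awalk (with_proj G) u p v}. enat (length p))"

definition graph_diameter :: "'a pair_pre_digraph \<Rightarrow> enat" where
  "graph_diameter G = (SUP u \<in> pverts G. SUP v \<in> pverts G. graph_dist G u v)"

definition neighbours_at_dist :: "'a pair_pre_digraph \<Rightarrow> 'a \<Rightarrow> 'a \<Rightarrow> enat \<Rightarrow> 'a set" where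
  "neighbours_at_dist G u v k = {w. (v, w) \<in> parcs G \<and> graph_dist G u w = k}"

text \<open>In the count of \<open>c\<^sub>i\<close> the distance \<open>i - 1\<close> is meaningful for \<open>i \<ge> 1\<close> only.\<close>

definition distance_regular :: "'a pair_pre_digraph \<Rightarrow> bool" where
  "distance_regular G \<longleftrightarrow> pair_graph G \<and> Digraph_Component.connected (with_proj G) \<and>
     (\<exists>b c :: nat \<Rightarrow> nat. \<forall>u\<in>pverts G. \<forall>v\<in>pverts G. \<forall>i. graph_dist G u v = enat i \<longrightarrow>
        card (neighbours_at_dist G u v (enat (i + 1))) = b i \<and>
        (i \<ge> 1 \<longrightarrow> card (neighbours_at_dist G u v (enat (i - 1))) = c i))"

text \<open>\<open>has_intersection_array G [b\<^sub>0, \<dots>, b\<^bsub>d-1\<^esub>] [c\<^sub>1, \<dots>, c\<^sub>d]\<close>, where \<open>d\<close> is the diameter;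
  hence \<open>c\<^sub>i\<close> is the list entry with index \<open>i - 1\<close>.\<close>

definition has_intersection_array :: "'a pair_pre_digraph \<Rightarrow> nat list \<Rightarrow> nat list \<Rightarrow> bool" where
  "has_intersection_array G bs cs \<longleftrightarrow>
     graph_diameter G = enat (length bs) \<and> length cs = length bs \<and>
     (\<forall>u\<in>pverts G. \<forall>v\<in>pverts G. \<forall>i. graph_dist G u v = enat i \<longrightarrow>
        (i < length bs \<longrightarrow> card (neighbours_at_dist G u v (enat (i + 1))) = bs ! i) \<and>
        (i \<ge> 1 \<longrightarrow> card (neighbours_at_dist G u v (enat (i - 1))) = cs ! (i - 1)))"

definition code_cosets :: "(gf4 ^ 'n) set \<Rightarrow> (gf4 ^ 'n) set set" where
  "code_cosets C = {(+) x ` C | x. True}"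

definition coset_graph :: "(gf4 ^ 'n) set \<Rightarrow> (gf4 ^ 'n) set pair_pre_digraph" where
  "coset_graph C = \<lparr> pverts = code_cosets C,
     parcs = {(X, Y). X \<in> code_cosets C \<and> Y \<in> code_cosets C \<and>
       (\<exists>x\<in>X. \<exists>y\<in>Y. hamming_weight (x - y) = 1)} \<rparr>"

definition D_minus_generators :: "(gf4 ^ 11) set" where
  "D_minus_generators = {
     vector [0, 0, 0, 0, 0, \<omega>\<^sup>2, \<omega>\<^sup>2, 0, \<omega>, 1, \<omega>],
     vector [0, 0, 0, 0, 0, \<omega>, 0, \<omega>, \<omega>, \<omega>, 1],
     vector [1, 0, 0, 0, 0, 1, 0, 1, \<omega>\<^sup>2, \<omega>\<^sup>2, 1],
     vector [\<omega>, 0, 0, 0, 0, 0, \<omega>, 1, \<omega>, \<omega>, \<omega>],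
     vector [0, 1, 0, 0, 0, 0, 1, 1, 1, \<omega>\<^sup>2, \<omega>\<^sup>2],
     vector [0, \<omega>, 0, 0, 0, \<omega>\<^sup>2, 1, \<omega>\<^sup>2, \<omega>, \<omega>, 0],
     vector [0, 0, 1, 0, 0, \<omega>, \<omega>, 1, 1, 0, 1],
     vector [0, 0, \<omega>, 0, 0, \<omega>, 1, \<omega>, \<omega>\<^sup>2, \<omega>\<^sup>2, 0],
     vector [0, 0, 0, 1, 0, \<omega>, \<omega>, \<omega>, 0, 1, \<omega>],
     vector [0, 0, 0, \<omega>, 0, \<omega>\<^sup>2, 1, 1, \<omega>\<^sup>2, 0, \<omega>],
     vector [0, 0, 0, 0, 1, \<omega>\<^sup>2, \<omega>\<^sup>2, \<omega>\<^sup>2, 1, 0, \<omega>\<^sup>2],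
     vector [0, 0, 0, 0, \<omega>, \<omega>, 1, 0, 1, \<omega>, \<omega>]}"

definition D_minus :: "(gf4 ^ 11) set" where
  "D_minus = gf2.span D_minus_generators"

end

theory Submission
  imports Defs
begin

text \<open>
  \<open>D_minus\<close> is the kernel of a syndrome map onto \<open>\<bbbF>\<^sub>2\<^sup>1\<^sup>0\<close>, so its coset graph is the Cayley graph of
  this group with respect to the syndromes of the \<open>33\<close> vectors of weight \<open>1\<close>, which are distinct
  and nonzero. Give each syndrome the weight \<open>0\<close>, \<open>1\<close>, \<open>2\<close> or \<open>3\<close> according to whether it is zero,
  one of the \<open>33\<close>, a sum of two of them, or anything else. A computation over all \<open>1024\<close> syndromes
  shows that the number of neighbours of weight \<open>k\<close> of a syndrome of weight \<open>w\<close> depends only on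
  \<open>w\<close> and \<open>k\<close>, that it vanishes for \<open>k > w + 1\<close>, and that it is positive for \<open>k = w - 1 \<ge> 0\<close>.
  Hence the weight is the distance from \<open>0\<close>, and these numbers are the intersection numbers.
\<close>

text \<open>Sums of bits stay sums in an abelian group of exponent 2 instead of becoming XOR, so the
  syndrome equations can be normalised by \<open>ac_simps\<close> and cancellation.\<close>

declare add_bit_eq_xor [simp del] mult_bit_eq_and [simp del]

section \<open>Distances in coset graphs\<close>

lemma (in pair_wf_digraph) awalk_length_bound:
  assumes "\<And>v w. (v, w) \<in> parcs G \<Longrightarrow> f w \<le> Suc (f v)" and "awalk u p v"
  shows "f v \<le> f u + length p"
  using assms(2)
proof (induction p arbitrary: u)
  case (Cons e p)
  then have "(u, snd e) \<in> parcs G" "awalk (snd e) p v"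
    by (auto simp: awalk_Cons_iff)
  then show ?case using Cons.IH[of "snd e"] assms(1)[of u "snd e"] by simp
qed (simp add: awalk_Nil_iff)

text \<open>Descending from \<open>w\<close> lowers \<open>f\<close> by 1 each time and can only end
  at \<open>u\<close>. The induction on \<open>f w\<close> appends the last arc, so the walk has
  exactly \<open>f w\<close> arcs.\<close>

lemma (in pair_wf_digraph) awalk_of_descent:
  assumes "\<And>v. v \<in> pverts G \<Longrightarrow> f v = 0 \<Longrightarrow> v = u"
    and "\<And>w n. w \<in> pverts G \<Longrightarrow> f w = Suc n \<Longrightarrow> \<exists>v. (v, w) \<in> parcs G \<and> f v = n"
    and "w \<in> pverts G"
  shows "\<exists>p. awalk u p w \<and> length p = f w"
  using assms(3)
proof (induction "f w" arbitrary: w)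
  case 0
  then have "awalk u [] w" using assms(1)[of w] by (simp add: awalk_Nil_iff)
  then show ?case using 0 by auto
next
  case (Suc n)
  then obtain v where v: "(v, w) \<in> parcs G" "f v = n" using assms(2)[of w n] by auto
  then obtain p where "awalk u p v" "length p = n"
    using Suc.hyps(1)[of v] in_arcsD1 by auto
  moreover have "awalk v [(v, w)] w"
    using arc_implies_awalk[OF v(1)] by simp
  ultimately have "awalk u (p @ [(v, w)]) w" "length (p @ [(v, w)]) = f w"
    using Suc.hyps(2) awalk_appendI by auto
  then show ?case by blast
qed

text \<open>Certificate for distances: growth of at most 1 per arc bounds the length of every walk
  from below, and descent produces a walk attaining the bound.\<close>

lemma (in pair_wf_digraph) graph_dist_eqI:
  assumes zero: "\<And>v. v \<in> pverts G \<Longrightarrow> f v = 0 \<longleftrightarrow> v = u"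
    and step: "\<And>v w. (v, w) \<in> parcs G \<Longrightarrow> f w \<le> Suc (f v)"
    and descent: "\<And>w n. w \<in> pverts G \<Longrightarrow> f w = Suc n \<Longrightarrow> \<exists>v. (v, w) \<in> parcs G \<and> f v = n"
    and verts: "u \<in> pverts G" "v \<in> pverts G"
  shows "graph_dist G u v = enat (f v)"
  unfolding graph_dist_def
proof (rule antisym)
  obtain p where "awalk u p v" "length p = f v"
    using awalk_of_descent[of f u v] zero descent verts by blast
  then show "(INF p\<in>{p. awalk u p v}. enat (length p)) \<le> enat (f v)"
    by (intro INF_lower2[of p]) auto
  have "f u = 0" using zero verts by blast
  then show "enat (f v) \<le> (INF p\<in>{p. awalk u p v}. enat (length p))"
    using awalk_length_bound[of f u _ v] step by (intro INF_greatest) auto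
qed

lemma finite_graph_dist_connected:
  assumes "pair_wf_digraph G" "pverts G \<noteq> {}"
    and "\<And>u v. u \<in> pverts G \<Longrightarrow> v \<in> pverts G \<Longrightarrow> graph_dist G u v \<noteq> \<infinity>"
  shows "Digraph_Component.connected (with_proj G)"
  unfolding Digraph_Component.connected_def
proof (rule strongly_connectedI)
  interpret pair_wf_digraph G by fact
  show "verts (with_proj (mk_symmetric (with_proj G))) \<noteq> {}"
    using assms(2) by (simp add: mk_symmetric_def)
  fix u v
  assume "u \<in> verts (with_proj (mk_symmetric (with_proj G)))"
    and "v \<in> verts (with_proj (mk_symmetric (with_proj G)))"
  then have "graph_dist G u v \<noteq> \<infinity>" using assms(3) by (simp add: mk_symmetric_def)
  \<comment> \<open>The infimum over no walks is the top element \<open>\<infinity>\<close>, so a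
    finite distance yields a walk.\<close>
  then have "{p. awalk u p v} \<noteq> {}" unfolding graph_dist_def
    by (metis image_empty Inf_empty top_enat_def)
  then have "u \<rightarrow>\<^sup>*\<^bsub>with_proj G\<^esub> v" using reachable_awalk by blast
  then show "u \<rightarrow>\<^sup>*\<^bsub>with_proj (mk_symmetric (with_proj G))\<^esub> v"
    by (rule reachable_mk_symmetricI)
qed

section \<open>Coset graphs of codes with a weight function\<close>

lemma hamming_weight_uminus: "hamming_weight (- x) = hamming_weight x"
  by (simp add: hamming_weight_def)

text \<open>\<open>wt_cong\<close> lets \<open>wt\<close> descend to vertices, and the next three
  assumptions feed the distance certificate \<open>graph_dist_eqI\<close>. The last two exclude
  loops and make different errors lead to different neighbours.\<close>

locale additive_code_weight =
  fixes C :: "(gf4 ^ 'n) set" and wt :: "gf4 ^ 'n \<Rightarrow> nat"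
  assumes code: "additive_code C"
    and wt_cong: "x - y \<in> C \<Longrightarrow> wt x = wt y"
    and wt_eq_0_iff: "wt x = 0 \<longleftrightarrow> x \<in> C"
    and wt_step: "hamming_weight e = 1 \<Longrightarrow> wt (x + e) \<le> Suc (wt x)"
    and wt_descent: "wt x = Suc n \<Longrightarrow> \<exists>e. hamming_weight e = 1 \<and> wt (x + e) = n"
    and weight_one_notin: "hamming_weight e = 1 \<Longrightarrow> e \<notin> C"
    and weight_one_inj: "hamming_weight e = 1 \<Longrightarrow> hamming_weight e' = 1 \<Longrightarrow> e - e' \<in> C \<Longrightarrow> e = e'"
begin

definition coset :: "gf4 ^ 'n \<Rightarrow> (gf4 ^ 'n) set" where
  "coset x = (+) x ` C"

lemma zero_in: "0 \<in> C" and add_in: "x \<in> C \<Longrightarrow> y \<in> C \<Longrightarrow> x + y \<in> C"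
  and uminus_in: "x \<in> C \<Longrightarrow> - x \<in> C"
  using code by (auto simp: additive_code_def)

lemma diff_in: "x \<in> C \<Longrightarrow> y \<in> C \<Longrightarrow> x - y \<in> C"
  using add_in uminus_in by fastforce

lemma mem_coset_iff: "y \<in> coset x \<longleftrightarrow> y - x \<in> C"
  unfolding coset_def image_iff by (metis add.commute add_diff_cancel_left' diff_add_cancel)

lemma coset_eq_iff: "coset x = coset y \<longleftrightarrow> x - y \<in> C"
proof
  assume "coset x = coset y"
  then show "x - y \<in> C" using mem_coset_iff[of x x] mem_coset_iff[of x y] zero_in by simp
next
  assume xy: "x - y \<in> C"
  have "z - x \<in> C \<longleftrightarrow> z - y \<in> C" for z
    using add_in[of "z - x" "x - y"] diff_in[of "z - y" "x - y"] xy by auto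
  then show "coset x = coset y" by (simp add: set_eq_iff mem_coset_iff)
qed

lemma pverts_coset_graph: "pverts (coset_graph C) = range coset"
  by (auto simp: coset_graph_def code_cosets_def coset_def)

lemma parcs_coset_graph_iff:
  "(coset x, Y) \<in> parcs (coset_graph C) \<longleftrightarrow> (\<exists>e. hamming_weight e = 1 \<and> Y = coset (x + e))"
proof
  assume "(coset x, Y) \<in> parcs (coset_graph C)"
  then obtain y a b where y: "Y = coset y" "a \<in> coset x" "b \<in> coset y" "hamming_weight (a - b) = 1"
    by (auto simp: coset_graph_def code_cosets_def simp flip: coset_def)
  \<comment> \<open>The error is \<open>b - a\<close>; replacing \<open>a\<close> by
    \<open>x\<close> and \<open>b\<close> by \<open>y\<close> changes it only by a codeword.\<close>
  have "hamming_weight (b - a) = 1"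
    using y(4) hamming_weight_uminus[of "a - b"] by simp
  moreover have "y - (x + (b - a)) \<in> C"
    using diff_in[of "a - x" "b - y"] y(2,3) unfolding mem_coset_iff by (simp add: algebra_simps)
  ultimately show "\<exists>e. hamming_weight e = 1 \<and> Y = coset (x + e)"
    using y(1) coset_eq_iff by metis
next
  assume "\<exists>e. hamming_weight e = 1 \<and> Y = coset (x + e)"
  then obtain e where e: "hamming_weight e = 1" "Y = coset (x + e)" by blast
  have "x \<in> coset x" "x + e \<in> coset (x + e)" unfolding mem_coset_iff by (simp_all add: zero_in)
  moreover have "hamming_weight (x - (x + e)) = 1" using e(1) hamming_weight_uminus[of e] by simp
  ultimately have "\<exists>a\<in>coset x. \<exists>b\<in>coset (x + e). hamming_weight (a - b) = 1" by blast
  then show "(coset x, Y) \<in> parcs (coset_graph C)"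
    unfolding coset_graph_def code_cosets_def e(2) coset_def[symmetric] by auto
qed

lemma pair_graph_coset_graph: "pair_graph (coset_graph C)"
proof
  show "fst e \<in> pverts (coset_graph C)" "snd e \<in> pverts (coset_graph C)"
    if "e \<in> parcs (coset_graph C)" for e
    using that by (auto simp: coset_graph_def)
  show "finite (pverts (coset_graph C))"
    by (simp add: pverts_coset_graph)
  show "finite (parcs (coset_graph C))"
    by (rule finite_subset[of _ "code_cosets C \<times> code_cosets C"])
      (auto simp: coset_graph_def code_cosets_def full_SetCompr_eq)
  show "fst e \<noteq> snd e" if arc: "e \<in> parcs (coset_graph C)" for e
  proof -
    obtain x where x: "fst e = coset x"
      using arc by (auto simp: coset_graph_def code_cosets_def simp flip: coset_def)
    then obtain d where d: "hamming_weight d = 1" "snd e = coset (x + d)"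
      using arc parcs_coset_graph_iff[of x "snd e"] by (cases e) auto
    then have "x + d - x \<notin> C" using weight_one_notin by simp
    then show ?thesis using x d coset_eq_iff by metis
  qed
  have "(Y, X) \<in> parcs (coset_graph C)" if "(X, Y) \<in> parcs (coset_graph C)" for X Y
  proof -
    obtain x y where "x \<in> X" "y \<in> Y" "hamming_weight (x - y) = 1"
      using \<open>(X, Y) \<in> parcs (coset_graph C)\<close> by (auto simp: coset_graph_def)
    moreover from this have "hamming_weight (y - x) = 1"
      using hamming_weight_uminus[of "x - y"] by simp
    ultimately show ?thesis using that unfolding coset_graph_def by auto
  qed
  then show "symmetric (with_proj (coset_graph C))"
    by (auto simp: symmetric_def sym_def)
qed

lemma graph_dist_coset_graph:
  "graph_dist (coset_graph C) (coset x) (coset y) = enat (wt (y - x))"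
proof -
  interpret pair_graph "coset_graph C" by (rule pair_graph_coset_graph)
  \<comment> \<open>The weight is transported to vertices through a chosen representative;
    \<open>wt_cong\<close> makes the choice irrelevant.\<close>
  define f where "f Y = wt ((SOME y. Y = coset y) - x)" for Y
  have f: "f (coset y) = wt (y - x)" for y
  proof -
    have "coset y = coset (SOME z. coset y = coset z)" by (rule someI) simp
    then show ?thesis unfolding f_def coset_eq_iff by (intro wt_cong[symmetric]) simp
  qed
  have "graph_dist (coset_graph C) (coset x) (coset y) = enat (f (coset y))"
  proof (rule graph_dist_eqI)
    fix V assume "V \<in> pverts (coset_graph C)"
    then obtain v where v: "V = coset v" by (auto simp: pverts_coset_graph)
    show "f V = 0 \<longleftrightarrow> V = coset x"
      unfolding v f wt_eq_0_iff coset_eq_iff ..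
  next
    fix V W assume arc: "(V, W) \<in> parcs (coset_graph C)"
    then obtain v where v: "V = coset v" using in_arcsD1 pverts_coset_graph by blast
    then obtain e where "hamming_weight e = 1" "W = coset (v + e)"
      using arc parcs_coset_graph_iff by auto
    then show "f W \<le> Suc (f V)"
      using wt_step[of e "v - x"] by (simp add: v f algebra_simps)
  next
    fix W n assume "W \<in> pverts (coset_graph C)" and n: "f W = Suc n"
    then obtain w where w: "W = coset w" by (auto simp: pverts_coset_graph)
    then obtain e where e: "hamming_weight e = 1" "wt (w - x + e) = n"
      using wt_descent n f by metis
    \<comment> \<open>\<open>wt_descent\<close> gives an arc leaving \<open>W\<close>, whereas the
      certificate asks for one entering \<open>W\<close>; symmetry turns it around.\<close>
    have "(coset w, coset (w + e)) \<in> parcs (coset_graph C)"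
      using e parcs_coset_graph_iff by blast
    then have "(coset (w + e), W) \<in> parcs (coset_graph C)"
      using sym_arcs arcs_symmetric w by blast
    moreover have "f (coset (w + e)) = n" using e(2) by (simp add: f algebra_simps)
    ultimately show "\<exists>V. (V, W) \<in> parcs (coset_graph C) \<and> f V = n" by blast
  qed (auto simp: pverts_coset_graph)
  then show ?thesis by (simp only: f)
qed

text \<open>By \<open>weight_one_inj\<close>, the errors of weight 1 parametrise the neighbours of a
  vertex without repetition, so counting neighbours becomes counting errors.\<close>

lemma card_neighbours_coset_graph:
  "card (neighbours_at_dist (coset_graph C) (coset x) (coset y) (enat k)) =
     card {e. hamming_weight e = 1 \<and> wt (y - x + e) = k}"
proof -
  have "neighbours_at_dist (coset_graph C) (coset x) (coset y) (enat k) =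
      (\<lambda>e. coset (y + e)) ` {e. hamming_weight e = 1 \<and> wt (y - x + e) = k}"
    unfolding neighbours_at_dist_def parcs_coset_graph_iff
    by (auto simp: graph_dist_coset_graph algebra_simps)
  moreover have "inj_on (\<lambda>e. coset (y + e)) {e. hamming_weight e = 1 \<and> wt (y - x + e) = k}"
    using weight_one_inj by (intro inj_onI) (simp add: coset_eq_iff)
  ultimately show ?thesis by (simp add: card_image)
qed

lemma connected_coset_graph: "Digraph_Component.connected (with_proj (coset_graph C))"
proof (rule finite_graph_dist_connected)
  interpret pair_graph "coset_graph C" by (rule pair_graph_coset_graph)
  show "pair_wf_digraph (coset_graph C)" ..
qed (auto simp: pverts_coset_graph graph_dist_coset_graph)

end

section \<open>Tables indexed by bit strings\<close>

text \<open>
  A table is a function on bit strings, stored as a decision tree that may stop early where the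
  function is constant; a missing bit is read as \<open>0\<close>.
\<close>

datatype 'a table = Leaf 'a | Node "'a table" "'a table"

fun lookup :: "'a table \<Rightarrow> bit list \<Rightarrow> 'a" where
  "lookup (Leaf n) bs = n"
| "lookup (Node l r) [] = lookup l []"
| "lookup (Node l r) (b # bs) = lookup (if b = 0 then l else r) bs"

text \<open>Adding 1 to the leading bit exchanges the two subtrees; a constant subtree is unaffected
  by any shift.\<close>

fun translate :: "bit list \<Rightarrow> 'a table \<Rightarrow> 'a table" where
  "translate (b # bs) (Node l r) =
     (if b = 0 then Node (translate bs l) (translate bs r) else Node (translate bs r) (translate bs l))"
| "translate bs t = t"

fun combine :: "('a \<Rightarrow> 'b \<Rightarrow> 'c) \<Rightarrow> 'a table \<Rightarrow> 'b table \<Rightarrow> 'c table" where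
  "combine f (Leaf m) (Leaf n) = Leaf (f m n)"
| "combine f (Leaf m) (Node l r) = Node (combine f (Leaf m) l) (combine f (Leaf m) r)"
| "combine f (Node l r) (Leaf n) = Node (combine f l (Leaf n)) (combine f r (Leaf n))"
| "combine f (Node l r) (Node l' r') = Node (combine f l l') (combine f r r')"

fun point :: "bit list \<Rightarrow> nat table" where
  "point [] = Leaf 1"
| "point (b # bs) = (if b = 0 then Node (point bs) (Leaf 0) else Node (Leaf 0) (point bs))"

fun all_true :: "bool table \<Rightarrow> bool" where
  "all_true (Leaf b) = b"
| "all_true (Node l r) = (all_true l \<and> all_true r)"

text \<open>For a connection set \<open>S\<close> this is the adjacency operator of the Cayley
  graph, evaluated at all points at once by merging shifted trees.\<close>

definition convolve :: "bit list list \<Rightarrow> nat table \<Rightarrow> nat table" where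
  "convolve S t = foldr (\<lambda>s. combine (+) (translate s t)) S (Leaf 0)"

text \<open>Equal lengths matter: \<open>map2\<close> truncates to the shorter list, while
  \<open>lookup\<close> pads with \<open>0\<close>.\<close>

lemma lookup_translate:
  "length s = length x \<Longrightarrow> lookup (translate s t) x = lookup t (map2 (+) x s)"
proof (induction s t arbitrary: x rule: translate.induct)
  case (1 b bs l r)
  then obtain c cs where "x = c # cs" "length bs = length cs" by (cases x) auto
  then show ?case using 1 by (cases b; cases c) auto
qed auto

lemma lookup_combine: "lookup (combine f s t) x = f (lookup s x) (lookup t x)"
proof (induction f s t arbitrary: x rule: combine.induct)
  case (1 f m n) show ?case by simp
next
  case (2 f m l r) then show ?case by (cases x) auto
next
  case (3 f l r n) then show ?case by (cases x) auto
next
  case (4 f l r l' r') then show ?case by (cases x) auto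
qed

lemma lookup_map_table: "lookup (map_table f t) x = f (lookup t x)"
  by (induction t x rule: lookup.induct) auto

lemma lookup_point: "length s = length x \<Longrightarrow> lookup (point s) x = of_bool (x = s)"
proof (induction s arbitrary: x)
  case (Cons b bs) then show ?case by (cases x; cases b) auto
qed simp

lemma all_true_lookup: "all_true t \<Longrightarrow> lookup t x"
  by (induction t x rule: lookup.induct) auto

lemma lookup_convolve:
  assumes "\<forall>s\<in>set S. length s = length x"
  shows "lookup (convolve S t) x = (\<Sum>s\<leftarrow>S. lookup t (map2 (+) x s))"
  using assms by (induction S) (simp_all add: convolve_def lookup_combine lookup_translate)

section \<open>The syndrome map of the code\<close>

lemma bit_add_self: "x + x = (0 :: bit)" "x + (x + y) = (y :: bit)"
  by (cases x; simp add: add.assoc[symmetric])+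

lemma bit_add_eq_0_iff: "a + b = 0 \<longleftrightarrow> a = b" for a b :: bit
  by (cases a; cases b; simp)

lemma exhaust_11:
  fixes i :: 11
  shows "i = 1 \<or> i = 2 \<or> i = 3 \<or> i = 4 \<or> i = 5 \<or> i = 6 \<or> i = 7 \<or> i = 8 \<or> i = 9 \<or> i = 10 \<or> i = 11"
proof (induct i)
  case (of_int z)
  \<comment> \<open>In the type \<open>11\<close> the numeral 11 equals 0, so the residue
    \<open>z = 0\<close> is the last coordinate.\<close>
  then have "z = 0 \<or> z = 1 \<or> z = 2 \<or> z = 3 \<or> z = 4 \<or> z = 5 \<or> z = 6 \<or> z = 7 \<or> z = 8 \<or> z = 9 \<or> z = 10"
    by simp arith
  then show ?case by auto
qed

lemma vector_11:
  fixes a b c d e f g h i j k :: "'a :: zero"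
  defines "v \<equiv> vector [a, b, c, d, e, f, g, h, i, j, k] :: 'a ^ 11"
  shows "v $ 1 = a" "v $ 2 = b" "v $ 3 = c" "v $ 4 = d" "v $ 5 = e" "v $ 6 = f"
    "v $ 7 = g" "v $ 8 = h" "v $ 9 = i" "v $ 10 = j" "v $ 11 = k"
  unfolding v_def vector_def by simp_all

lemma gf4_sel:
  "gf4_fst 0 = 0" "gf4_snd 0 = 0" "gf4_fst 1 = 1" "gf4_snd 1 = 0"
  "gf4_fst \<omega> = 0" "gf4_snd \<omega> = 1" "gf4_fst (\<omega>\<^sup>2) = 1" "gf4_snd (\<omega>\<^sup>2) = 1"
  "gf4_fst (x + y) = gf4_fst x + gf4_fst y" "gf4_snd (x + y) = gf4_snd x + gf4_snd y"
  "gf4_fst (GF4 c 0 * x) = c * gf4_fst x" "gf4_snd (GF4 c 0 * x) = c * gf4_snd x"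
  by (simp_all add: \<omega>_def power2_eq_square gf4_arith_defs)

text \<open>
  Use generators 3 to 12 to clear the first five coordinates of \<open>x\<close>, then generators 1 and 2 to
  clear the first bit of coordinate 7 and the second bit of coordinate 8. The ten bits that are
  left form the syndrome; in each sum below the first summand is the bit it comes from.
\<close>

definition syndrome :: "gf4 ^ 11 \<Rightarrow> bit list" where
  "syndrome x = 
   [gf4_fst (x $ 6) + gf4_fst (x $ 1) + gf4_fst (x $ 2) + gf4_snd (x $ 3) + gf4_snd (x $ 5) +
       gf4_fst (x $ 7),
    gf4_snd (x $ 6) + gf4_fst (x $ 2) + gf4_snd (x $ 2) + gf4_fst (x $ 3) + gf4_snd (x $ 3) +
       gf4_fst (x $ 5) + gf4_fst (x $ 7) + gf4_snd (x $ 8),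
    gf4_snd (x $ 7) + gf4_snd (x $ 1) + gf4_fst (x $ 2) + gf4_snd (x $ 2) + gf4_fst (x $ 3) +
       gf4_snd (x $ 3) + gf4_fst (x $ 4) + gf4_snd (x $ 4) + gf4_snd (x $ 5) + gf4_fst (x $ 7),
    gf4_fst (x $ 8) + gf4_fst (x $ 1) + gf4_snd (x $ 1) + gf4_fst (x $ 2) + gf4_snd (x $ 2) +
       gf4_fst (x $ 3) + gf4_snd (x $ 4) + gf4_fst (x $ 5),
    gf4_fst (x $ 9) + gf4_fst (x $ 1) + gf4_fst (x $ 2) + gf4_fst (x $ 3) + gf4_snd (x $ 3) +
       gf4_snd (x $ 4) + gf4_fst (x $ 5) + gf4_snd (x $ 5),
    gf4_snd (x $ 9) + gf4_fst (x $ 1) + gf4_snd (x $ 1) + gf4_fst (x $ 2) + gf4_snd (x $ 2) +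
       gf4_snd (x $ 3) + gf4_fst (x $ 4) + gf4_snd (x $ 5) + gf4_fst (x $ 7) + gf4_snd (x $ 8),
    gf4_fst (x $ 10) + gf4_fst (x $ 1) + gf4_snd (x $ 2) + gf4_fst (x $ 4) + gf4_snd (x $ 4) +
       gf4_fst (x $ 5) + gf4_snd (x $ 5) + gf4_fst (x $ 7),
    gf4_snd (x $ 10) + gf4_fst (x $ 1) + gf4_snd (x $ 1) + gf4_fst (x $ 2) + gf4_fst (x $ 4) +
       gf4_fst (x $ 5) + gf4_snd (x $ 5) + gf4_snd (x $ 8),
    gf4_fst (x $ 11) + gf4_fst (x $ 1) + gf4_fst (x $ 2) + gf4_snd (x $ 2) + gf4_fst (x $ 3) +
       gf4_snd (x $ 3) + gf4_fst (x $ 4) + gf4_snd (x $ 8),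
    gf4_snd (x $ 11) + gf4_snd (x $ 1) + gf4_snd (x $ 2) + gf4_snd (x $ 3) + gf4_fst (x $ 4) +
       gf4_fst (x $ 7)]"

lemma replicate_10: "replicate 10 x = [x, x, x, x, x, x, x, x, x, x]"
  by (simp add: numeral_eq_Suc)

lemma length_syndrome: "length (syndrome x) = 10"
  by (simp add: syndrome_def)

lemma syndrome_add: "syndrome (x + y) = map2 (+) (syndrome x) (syndrome y)"
  by (simp add: syndrome_def gf4_sel ac_simps)

lemma syndrome_zero: "syndrome 0 = replicate 10 0"
  by (simp add: syndrome_def gf4_sel replicate_10)

lemma syndrome_generator: "g \<in> D_minus_generators \<Longrightarrow> syndrome g = replicate 10 0"
  by (auto simp: D_minus_generators_def syndrome_def vector_11 gf4_sel replicate_10)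

text \<open>Gaussian elimination, run explicitly: a vector of zero syndrome is written as a
  combination of the generators.\<close>

lemma kernel_subset_D_minus:
  assumes "syndrome x = replicate 10 0"
  shows "x \<in> D_minus"
proof -
  \<comment> \<open>Each vanishing syndrome bit is solved for its first summand, since minus is plus
    over the field of two elements.\<close>
  have eqs:
    "gf4_fst (x $ 6) = gf4_fst (x $ 1) + gf4_fst (x $ 2) + gf4_snd (x $ 3) + gf4_snd (x $ 5) +
      gf4_fst (x $ 7)"
    "gf4_snd (x $ 6) = gf4_fst (x $ 2) + gf4_snd (x $ 2) + gf4_fst (x $ 3) + gf4_snd (x $ 3) +
      gf4_fst (x $ 5) + gf4_fst (x $ 7) + gf4_snd (x $ 8)"
    "gf4_snd (x $ 7) = gf4_snd (x $ 1) + gf4_fst (x $ 2) + gf4_snd (x $ 2) + gf4_fst (x $ 3) +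
      gf4_snd (x $ 3) + gf4_fst (x $ 4) + gf4_snd (x $ 4) + gf4_snd (x $ 5) + gf4_fst (x $ 7)"
    "gf4_fst (x $ 8) = gf4_fst (x $ 1) + gf4_snd (x $ 1) + gf4_fst (x $ 2) + gf4_snd (x $ 2) +
      gf4_fst (x $ 3) + gf4_snd (x $ 4) + gf4_fst (x $ 5)"
    "gf4_fst (x $ 9) = gf4_fst (x $ 1) + gf4_fst (x $ 2) + gf4_fst (x $ 3) + gf4_snd (x $ 3) +
      gf4_snd (x $ 4) + gf4_fst (x $ 5) + gf4_snd (x $ 5)"
    "gf4_snd (x $ 9) = gf4_fst (x $ 1) + gf4_snd (x $ 1) + gf4_fst (x $ 2) + gf4_snd (x $ 2) +
      gf4_snd (x $ 3) + gf4_fst (x $ 4) + gf4_snd (x $ 5) + gf4_fst (x $ 7) + gf4_snd (x $ 8)"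
    "gf4_fst (x $ 10) = gf4_fst (x $ 1) + gf4_snd (x $ 2) + gf4_fst (x $ 4) + gf4_snd (x $ 4) +
      gf4_fst (x $ 5) + gf4_snd (x $ 5) + gf4_fst (x $ 7)"
    "gf4_snd (x $ 10) = gf4_fst (x $ 1) + gf4_snd (x $ 1) + gf4_fst (x $ 2) + gf4_fst (x $ 4) +
      gf4_fst (x $ 5) + gf4_snd (x $ 5) + gf4_snd (x $ 8)"
    "gf4_fst (x $ 11) = gf4_fst (x $ 1) + gf4_fst (x $ 2) + gf4_snd (x $ 2) + gf4_fst (x $ 3) +
      gf4_snd (x $ 3) + gf4_fst (x $ 4) + gf4_snd (x $ 8)"
    "gf4_snd (x $ 11) = gf4_snd (x $ 1) + gf4_snd (x $ 2) + gf4_snd (x $ 3) + gf4_fst (x $ 4) +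
      gf4_fst (x $ 7)"
    using assms by (simp_all add: syndrome_def replicate_10 add.assoc bit_add_eq_0_iff)
  \<comment> \<open>The coefficients of generators 3 to 12 are the bits of the first five
    coordinates. The first two coefficients are what these generators leave over in the first bit of
    coordinate 7 and the second bit of coordinate 8.\<close>
  define y :: "gf4 ^ 11" where "y = gf2_scale (gf4_fst (x $ 7) + gf4_fst (x $ 2) + gf4_snd (x $ 2) + gf4_snd (x $ 3) + gf4_snd (x $ 4) + gf4_fst (x $ 5) + gf4_snd (x $ 5))
        (vector [0, 0, 0, 0, 0, \<omega>\<^sup>2, \<omega>\<^sup>2, 0, \<omega>, 1, \<omega>])
      + gf2_scale (gf4_snd (x $ 8) + gf4_snd (x $ 2) + gf4_snd (x $ 3) + gf4_fst (x $ 4) + gf4_fst (x $ 5))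
        (vector [0, 0, 0, 0, 0, \<omega>, 0, \<omega>, \<omega>, \<omega>, 1])
      + gf2_scale (gf4_fst (x $ 1))
        (vector [1, 0, 0, 0, 0, 1, 0, 1, \<omega>\<^sup>2, \<omega>\<^sup>2, 1])
      + gf2_scale (gf4_snd (x $ 1))
        (vector [\<omega>, 0, 0, 0, 0, 0, \<omega>, 1, \<omega>, \<omega>, \<omega>])
      + gf2_scale (gf4_fst (x $ 2))
        (vector [0, 1, 0, 0, 0, 0, 1, 1, 1, \<omega>\<^sup>2, \<omega>\<^sup>2])
      + gf2_scale (gf4_snd (x $ 2))
        (vector [0, \<omega>, 0, 0, 0, \<omega>\<^sup>2, 1, \<omega>\<^sup>2, \<omega>, \<omega>, 0])
      + gf2_scale (gf4_fst (x $ 3))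
        (vector [0, 0, 1, 0, 0, \<omega>, \<omega>, 1, 1, 0, 1])
      + gf2_scale (gf4_snd (x $ 3))
        (vector [0, 0, \<omega>, 0, 0, \<omega>, 1, \<omega>, \<omega>\<^sup>2, \<omega>\<^sup>2, 0])
      + gf2_scale (gf4_fst (x $ 4))
        (vector [0, 0, 0, 1, 0, \<omega>, \<omega>, \<omega>, 0, 1, \<omega>])
      + gf2_scale (gf4_snd (x $ 4))
        (vector [0, 0, 0, \<omega>, 0, \<omega>\<^sup>2, 1, 1, \<omega>\<^sup>2, 0, \<omega>])
      + gf2_scale (gf4_fst (x $ 5))
        (vector [0, 0, 0, 0, 1, \<omega>\<^sup>2, \<omega>\<^sup>2, \<omega>\<^sup>2, 1, 0, \<omega>\<^sup>2])
      + gf2_scale (gf4_snd (x $ 5))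
        (vector [0, 0, 0, 0, \<omega>, \<omega>, 1, 0, 1, \<omega>, \<omega>])"
  have "gf4_fst (x $ i) = gf4_fst (y $ i) \<and> gf4_snd (x $ i) = gf4_snd (y $ i)" for i
    using exhaust_11[of i]
    by (elim disjE; simp add: y_def gf2_scale_def vector_11 gf4_sel;
        simp only: eqs ac_simps bit_add_self add_0_left add_0_right)
  then have "x $ i = y $ i" for i by (rule gf4.expand)
  then have "x = y" by (intro vec_eq_iff[THEN iffD2] allI)
  moreover have "y \<in> D_minus"
    unfolding D_minus_def y_def
    by (intro gf2.span_add gf2.span_scale gf2.span_base; simp add: D_minus_generators_def)
  ultimately show ?thesis by simp
qed

lemma syndrome_gf2_scale:
  "syndrome x = replicate 10 0 \<Longrightarrow> syndrome (gf2_scale c x) = replicate 10 0"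
  by (cases c) (simp_all add: syndrome_zero gf2.scale_zero_left gf2.scale_one)

lemma D_minus_eq_kernel: "x \<in> D_minus \<longleftrightarrow> syndrome x = replicate 10 0"
proof
  assume "x \<in> D_minus"
  then show "syndrome x = replicate 10 0"
    unfolding D_minus_def
  proof (induction rule: gf2.span_induct_alt)
    case base show ?case by (rule syndrome_zero)
  next
    case (step c g y)
    then have "syndrome (gf2_scale c g) = replicate 10 0"
      by (intro syndrome_gf2_scale syndrome_generator)
    then show ?case using step by (simp add: syndrome_add replicate_10)
  qed
next
  assume "syndrome x = replicate 10 0"
  then show "x \<in> D_minus" by (rule kernel_subset_D_minus)
qed

section \<open>Vectors of weight 1 and their syndromes\<close>

lemma hamming_weight_eq_1_iff: "hamming_weight x = 1 \<longleftrightarrow> (\<exists>i a. a \<noteq> 0 \<and> x = axis i a)"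
proof
  assume "hamming_weight x = 1"
  then obtain i where i: "{i. x $ i \<noteq> 0} = {i}"
    by (auto simp: hamming_weight_def card_1_singleton_iff)
  then have "x $ i \<noteq> 0" "x = axis i (x $ i)"
    by (auto simp: vec_eq_iff axis_def set_eq_iff)
  then show "\<exists>i a. a \<noteq> 0 \<and> x = axis i a" by blast
next
  assume "\<exists>i a. a \<noteq> 0 \<and> x = axis i a"
  then obtain i a where "a \<noteq> 0" "x = axis i a" by blast
  then have "{i. x $ i \<noteq> 0} = {i}" by (auto simp: axis_def)
  then show "hamming_weight x = 1" by (simp add: hamming_weight_def)
qed

definition unit_errors :: "(gf4 ^ 11) list" where
  "unit_errors = concat (map (\<lambda>i. map (axis i) [1, \<omega>, \<omega>\<^sup>2]) [1, 2, 3, 4, 5, 6, 7, 8, 9, 10, 11])"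

lemma set_unit_errors: "set unit_errors = {e. hamming_weight e = 1}"
proof -
  have "a \<noteq> 0 \<longleftrightarrow> a \<in> {1, \<omega>, \<omega>\<^sup>2}" for a :: gf4
  proof -
    have "a \<in> {0, 1, \<omega>, \<omega>\<^sup>2}" using UNIV_gf4 by blast
    moreover have "(1 :: gf4) \<noteq> 0" "\<omega> \<noteq> 0" by (simp_all add: \<omega>_def gf4_arith_defs)
    ultimately show ?thesis by auto
  qed
  then have "set [1, \<omega>, \<omega>\<^sup>2] = {a :: gf4. a \<noteq> 0}" by auto
  moreover have "set [1, 2, 3, 4, 5, 6, 7, 8, 9, 10, 11] = (UNIV :: 11 set)"
    using exhaust_11 by auto
  ultimately have "set unit_errors = (\<Union>i. axis i ` {a. a \<noteq> 0})"
    by (simp only: unit_errors_def set_concat set_map image_image)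
  then show ?thesis by (simp only: hamming_weight_eq_1_iff) auto
qed

text \<open>Written out so that evaluation works on bit lists alone. Each block of three belongs to
  one coordinate, with entries 1, \<omega> and \<omega> + 1 in the order of
  \<open>unit_errors\<close>.\<close>

definition error_syndromes :: "bit list list" where
  "error_syndromes =
    [[1, 0, 0, 1, 1, 1, 1, 1, 1, 0], [0, 0, 1, 1, 0, 1, 0, 1, 0, 1], [1, 0, 1, 0, 1, 0, 1, 0, 1, 1],
     [1, 1, 1, 1, 1, 1, 0, 1, 1, 0], [0, 1, 1, 1, 0, 1, 1, 0, 1, 1], [1, 0, 0, 0, 1, 0, 1, 1, 0, 1],
     [0, 1, 1, 1, 1, 0, 0, 0, 1, 0], [1, 1, 1, 0, 1, 1, 0, 0, 1, 1], [1, 0, 0, 1, 0, 1, 0, 0, 0, 1],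
     [0, 0, 1, 0, 0, 1, 1, 1, 1, 1], [0, 0, 1, 1, 1, 0, 1, 0, 0, 0], [0, 0, 0, 1, 1, 1, 0, 1, 1, 1],
     [0, 1, 0, 1, 1, 0, 1, 1, 0, 0], [1, 0, 1, 0, 1, 1, 1, 1, 0, 0], [1, 1, 1, 1, 0, 1, 0, 0, 0, 0],
     [1, 0, 0, 0, 0, 0, 0, 0, 0, 0], [0, 1, 0, 0, 0, 0, 0, 0, 0, 0], [1, 1, 0, 0, 0, 0, 0, 0, 0, 0],
     [1, 1, 1, 0, 0, 1, 1, 0, 0, 1], [0, 0, 1, 0, 0, 0, 0, 0, 0, 0], [1, 1, 0, 0, 0, 1, 1, 0, 0, 1],
     [0, 0, 0, 1, 0, 0, 0, 0, 0, 0], [0, 1, 0, 0, 0, 1, 0, 1, 1, 0], [0, 1, 0, 1, 0, 1, 0, 1, 1, 0],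
     [0, 0, 0, 0, 1, 0, 0, 0, 0, 0], [0, 0, 0, 0, 0, 1, 0, 0, 0, 0], [0, 0, 0, 0, 1, 1, 0, 0, 0, 0],
     [0, 0, 0, 0, 0, 0, 1, 0, 0, 0], [0, 0, 0, 0, 0, 0, 0, 1, 0, 0], [0, 0, 0, 0, 0, 0, 1, 1, 0, 0],
     [0, 0, 0, 0, 0, 0, 0, 0, 1, 0], [0, 0, 0, 0, 0, 0, 0, 0, 0, 1], [0, 0, 0, 0, 0, 0, 0, 0, 1, 1]]"

lemma syndrome_unit_errors: "map syndrome unit_errors = error_syndromes"
  by (simp add: unit_errors_def error_syndromes_def syndrome_def axis_def gf4_sel)

lemma length_error_syndrome: "s \<in> set error_syndromes \<Longrightarrow> length s = 10"
  by (auto simp: error_syndromes_def)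

text \<open>Equivalently, the code has no nonzero word of weight at most 2; hence the coset graph
  has no loops and valency 33.\<close>

lemma distinct_error_syndromes: "distinct (replicate 10 0 # error_syndromes)"
  by code_simp

section \<open>The weight of a syndrome\<close>

definition walk_count_1 :: "nat table" where
  "walk_count_1 = convolve error_syndromes (point (replicate 10 0))"

definition walk_count_2 :: "nat table" where
  "walk_count_2 = convolve error_syndromes walk_count_1"

text \<open>The cases are tried in the order zero, one error, two errors. The label 3 is only a
  default here; that it is a distance follows from the counts below.\<close>

definition weight_table :: "nat table" where
  "weight_table = combine (\<lambda>p w. if p = 1 then 0 else w) (point (replicate 10 0))
     (combine (\<lambda>m n. if m > 0 then 1 else if n > 0 then 2 else 3) walk_count_1 walk_count_2)"

text \<open>Row \<open>w\<close> lists the intersection numbers \<open>c\<^sub>w\<close>, \<open>a\<^sub>w\<close>, \<open>b\<^sub>w\<close> in columns \<open>w - 1\<close>, \<open>w\<close>, \<open>w + 1\<close>.\<close>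

definition neighbour_count :: "nat \<Rightarrow> nat \<Rightarrow> nat" where
  "neighbour_count w k = [[0, 33, 0, 0], [1, 2, 30, 0], [0, 2, 16, 15], [0, 0, 15, 18]] ! w ! k"

text \<open>Convolving the indicator of weight \<open>k\<close> counts, for every syndrome
  simultaneously, its neighbours of weight \<open>k\<close>.\<close>

definition neighbour_counts_correct :: "nat \<Rightarrow> bool" where
  "neighbour_counts_correct k \<longleftrightarrow>
     all_true (combine (\<lambda>w n. n = neighbour_count w k) weight_table
       (convolve error_syndromes (map_table (\<lambda>w. of_bool (w = k)) weight_table)))"

text \<open>The computational core: the four evaluations cover all syndromes and all target
  weights.\<close>

lemma neighbour_counts_correct:
  "neighbour_counts_correct 0" "neighbour_counts_correct 1"
  "neighbour_counts_correct 2" "neighbour_counts_correct 3"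
  by code_simp+

definition syndrome_weight :: "gf4 ^ 11 \<Rightarrow> nat" where
  "syndrome_weight x = lookup weight_table (syndrome x)"

lemma syndrome_weight_less: "syndrome_weight x < 4"
  by (simp add: syndrome_weight_def weight_table_def lookup_combine)

lemma syndrome_weight_eq_0_iff: "syndrome_weight x = 0 \<longleftrightarrow> x \<in> D_minus"
  by (simp add: syndrome_weight_def weight_table_def lookup_combine lookup_point length_syndrome
      D_minus_eq_kernel)

lemma length_filter_eq_sum_list: "length (filter P xs) = (\<Sum>x\<leftarrow>xs. of_bool (P x))"
  by (induction xs) auto

lemma less_4_cases: "n < 4 \<Longrightarrow> n = 0 \<or> n = 1 \<or> n = 2 \<or> n = (3 :: nat)"
  by auto

text \<open>Carries the table check over to vectors: the set of errors is counted along the list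
  \<open>unit_errors\<close>, whose image under the syndrome map is the list being
  convolved.\<close>

lemma card_unit_errors_weight:
  assumes "k < 4"
  shows "card {e. hamming_weight e = 1 \<and> syndrome_weight (x + e) = k} =
    neighbour_count (syndrome_weight x) k"
proof -
  let ?P = "\<lambda>s. lookup weight_table (map2 (+) (syndrome x) s) = k"
  \<comment> \<open>Errors with distinct syndromes are distinct.\<close>
  have "distinct unit_errors"
    using distinct_error_syndromes by (auto simp: distinct_map simp flip: syndrome_unit_errors)
  moreover have "{e. hamming_weight e = 1 \<and> syndrome_weight (x + e) = k} =
      set (filter (?P \<circ> syndrome) unit_errors)"
    by (auto simp: set_unit_errors syndrome_weight_def syndrome_add)
  ultimately have "card {e. hamming_weight e = 1 \<and> syndrome_weight (x + e) = k} =
      length (filter (?P \<circ> syndrome) unit_errors)"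
    by (simp only: distinct_card distinct_filter)
  also have "\<dots> = length (filter ?P error_syndromes)"
    by (simp add: filter_map flip: syndrome_unit_errors)
  also have "\<dots> = (\<Sum>s\<leftarrow>error_syndromes. of_bool (?P s))"
    by (rule length_filter_eq_sum_list)
  also have "\<dots> = lookup (convolve error_syndromes
      (map_table (\<lambda>w. of_bool (w = k)) weight_table)) (syndrome x)"
    by (simp add: lookup_convolve lookup_map_table length_syndrome length_error_syndrome)
  also have "\<dots> = neighbour_count (syndrome_weight x) k"
  proof -
    have "neighbour_counts_correct k"
      using less_4_cases[OF assms] neighbour_counts_correct by blast
    from all_true_lookup[OF this[unfolded neighbour_counts_correct_def], of "syndrome x"]
    show ?thesis
      by (simp add: lookup_combine syndrome_weight_def)
  qed
  finally show ?thesis .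
qed

text \<open>The entries 33, 30, 15 above the diagonal are nonzero, so one can climb from the zero
  vector through weights 1 and 2 to 3 without exhibiting a vector.\<close>

lemma ex_syndrome_weight_3: "\<exists>x. syndrome_weight x = 3"
proof -
  have ascent: "\<exists>y. syndrome_weight y = Suc n" if n: "syndrome_weight x = n" "n < 3" for x n
  proof -
    have "n = 0 \<or> n = 1 \<or> n = 2" using n(2) by auto
    then have "neighbour_count n (Suc n) \<noteq> 0" by (auto simp: neighbour_count_def)
    then have "card {e. hamming_weight e = 1 \<and> syndrome_weight (x + e) = Suc n} \<noteq> 0"
      using card_unit_errors_weight[of "Suc n" x] n by simp
    then have "{e. hamming_weight e = 1 \<and> syndrome_weight (x + e) = Suc n} \<noteq> {}"
      by (metis card.empty)
    then show ?thesis by blast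
  qed
  have "syndrome_weight 0 = 0"
    by (simp add: syndrome_weight_eq_0_iff D_minus_def gf2.span_zero)
  then obtain x where "syndrome_weight x = 1" using ascent[of 0 0] by auto
  then obtain y where "syndrome_weight y = 2" using ascent[of x 1] by (auto simp: numeral_2_eq_2)
  then show ?thesis using ascent[of y 2] by simp
qed

section \<open>Distance-regularity of the coset graph\<close>

interpretation D_minus: additive_code_weight D_minus syndrome_weight
proof
  show "additive_code D_minus"
    unfolding D_minus_def by (rule additive_code_gf2_span)
  fix x y e e' :: "gf4 ^ 11" and n
  have cong: "syndrome x = syndrome y" if "x - y \<in> D_minus" for x y
  proof -
    have "syndrome (y + (x - y)) = map2 (+) (syndrome y) (replicate 10 0)"
      using that unfolding syndrome_add D_minus_eq_kernel by simp
    also have "\<dots> = syndrome y" by (simp add: syndrome_def replicate_10)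
    finally show ?thesis by simp
  qed
  show "x - y \<in> D_minus \<Longrightarrow> syndrome_weight x = syndrome_weight y"
    using cong by (simp add: syndrome_weight_def)
  show "syndrome_weight x = 0 \<longleftrightarrow> x \<in> D_minus" by (rule syndrome_weight_eq_0_iff)
  show "syndrome_weight (x + e) \<le> Suc (syndrome_weight x)" if "hamming_weight e = 1"
  proof -
    have "e \<in> {e'. hamming_weight e' = 1 \<and> syndrome_weight (x + e') = syndrome_weight (x + e)}"
      using that by simp
    \<comment> \<open>The error \<open>e\<close> itself makes this entry positive, and row
      \<open>w\<close> of the table vanishes beyond column \<open>w + 1\<close>.\<close>
    then have "neighbour_count (syndrome_weight x) (syndrome_weight (x + e)) \<noteq> 0"
      unfolding card_unit_errors_weight[OF syndrome_weight_less, symmetric] by auto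
    then show ?thesis
      using less_4_cases[OF syndrome_weight_less[of x]]
        less_4_cases[OF syndrome_weight_less[of "x + e"]]
      by (auto simp: neighbour_count_def)
  qed
  show "\<exists>e. hamming_weight e = 1 \<and> syndrome_weight (x + e) = n" if "syndrome_weight x = Suc n"
  proof -
    \<comment> \<open>The entries 1, 2, 15 below the diagonal are positive, so a descending error
      exists.\<close>
    have "n < 4" "neighbour_count (Suc n) n \<noteq> 0"
      using that less_4_cases[OF syndrome_weight_less[of x]]
      by (auto simp: neighbour_count_def)
    then have "card {e. hamming_weight e = 1 \<and> syndrome_weight (x + e) = n} \<noteq> 0"
      by (simp only: card_unit_errors_weight that not_False_eq_True)
    then have "{e. hamming_weight e = 1 \<and> syndrome_weight (x + e) = n} \<noteq> {}"
      by (metis card.empty)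
    then show ?thesis by blast
  qed
  have distinct: "distinct (map syndrome unit_errors)" "replicate 10 0 \<notin> set (map syndrome unit_errors)"
    using distinct_error_syndromes unfolding syndrome_unit_errors by simp_all
  show "e \<notin> D_minus" if "hamming_weight e = 1"
    using that distinct(2) unfolding D_minus_eq_kernel by (force simp: set_unit_errors)
  show "e = e'" if "hamming_weight e = 1" "hamming_weight e' = 1" "e - e' \<in> D_minus"
    using distinct(1) cong[OF that(3)] that(1,2)
    by (simp add: distinct_map set_unit_errors inj_on_def)
qed

theorem theorem8:
  shows "distance_regular (coset_graph D_minus) \<and>
    has_intersection_array (coset_graph D_minus) [33, 30, 15] [1, 2, 15]"
proof -
  let ?G = "coset_graph D_minus"
  \<comment> \<open>The extra entry 0 is the value of b at distance 3:
    \<open>distance_regular\<close> asks for it, while the intersection array stops before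
    it.\<close>
  have counts: "card (neighbours_at_dist ?G u v (enat (i + 1))) = [33, 30, 15, 0] ! i"
    "i \<ge> 1 \<longrightarrow> card (neighbours_at_dist ?G u v (enat (i - 1))) = [1, 2, 15] ! (i - 1)" "i < 4"
    if verts: "u \<in> pverts ?G" "v \<in> pverts ?G" and dist: "graph_dist ?G u v = enat i" for u v i
  proof -
    obtain x y where u: "u = D_minus.coset x" and v: "v = D_minus.coset y"
      using verts by (auto simp: D_minus.pverts_coset_graph)
    have i: "syndrome_weight (y - x) = i"
      using dist by (simp add: u v D_minus.graph_dist_coset_graph)
    show "i < 4" using i syndrome_weight_less by metis
    \<comment> \<open>For \<open>i = 3\<close> the column \<open>i + 1 = 4\<close> lies outside the
      table; no syndrome has weight 4, so the count is 0.\<close>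
    have "{e. hamming_weight e = 1 \<and> syndrome_weight (y - x + e) = 4} = {}"
      using syndrome_weight_less nat_neq_iff by blast
    then show "card (neighbours_at_dist ?G u v (enat (i + 1))) = [33, 30, 15, 0] ! i"
      unfolding u v D_minus.card_neighbours_coset_graph
      using less_4_cases[OF \<open>i < 4\<close>] card_unit_errors_weight[of "i + 1" "y - x"]
      by (elim disjE) (simp_all add: i neighbour_count_def)
    show "i \<ge> 1 \<longrightarrow> card (neighbours_at_dist ?G u v (enat (i - 1))) = [1, 2, 15] ! (i - 1)"
      unfolding u v D_minus.card_neighbours_coset_graph
      using less_4_cases[OF \<open>i < 4\<close>] card_unit_errors_weight[of "i - 1" "y - x"]
      by (elim disjE) (simp_all add: i neighbour_count_def)
  qed
  have "graph_diameter ?G = enat 3"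
    unfolding graph_diameter_def
  proof (rule antisym)
    have "graph_dist ?G u v \<le> enat 3" if "u \<in> pverts ?G" "v \<in> pverts ?G" for u v
      using that syndrome_weight_less
      by (auto simp: D_minus.pverts_coset_graph D_minus.graph_dist_coset_graph less_Suc_eq_le[symmetric])
    then show "(SUP u\<in>pverts ?G. SUP v\<in>pverts ?G. graph_dist ?G u v) \<le> enat 3"
      by (intro SUP_least)
    obtain x where "syndrome_weight x = 3" using ex_syndrome_weight_3 ..
    then have "enat 3 = graph_dist ?G (D_minus.coset 0) (D_minus.coset x)"
      by (simp add: D_minus.graph_dist_coset_graph)
    then show "enat 3 \<le> (SUP u\<in>pverts ?G. SUP v\<in>pverts ?G. graph_dist ?G u v)"
      by (intro SUP_upper2[of "D_minus.coset 0"] SUP_upper2[of "D_minus.coset x"])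
        (simp_all add: D_minus.pverts_coset_graph)
  qed
  moreover have "[33, 30, 15, 0 :: nat] ! i = [33, 30, 15] ! i" if "i < 3" for i
    using that by (auto simp: less_Suc_eq numeral_3_eq_3)
  ultimately have "has_intersection_array ?G [33, 30, 15] [1, 2, 15]"
    unfolding has_intersection_array_def using counts by simp
  moreover have "distance_regular ?G"
    unfolding distance_regular_def
    using D_minus.pair_graph_coset_graph D_minus.connected_coset_graph counts(1,2)
    \<comment> \<open>At \<open>i = 0\<close> the truncated index \<open>i - 1\<close> is 0, but the
      condition on c is guarded by \<open>i \<ge> 1\<close>.\<close>
    by (intro conjI exI[of _ "\<lambda>i. [33, 30, 15, 0] ! i"] exI[of _ "\<lambda>i. [1, 2, 15] ! (i - 1)"]) auto
  ultimately show ?thesis by blast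
qed

end
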